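(* Let $K=(k(1),\dots,k(n))\in\mathbb{Z}_{\ge0}^n$, $K\neq 0$, and $d^K=\prod_{i=1}^n d_{n,i}^{k(i)}$. For each $i$ with $k(i)\neq0$, let $a_ip^{m_i}$ ($1\le a_i\le p-1$) be the lowest nonzero term of the $p$-adic expansion of $k(i)$, and set $e_i=m_i+n-i-1$ for $i<n$ and $e_n=m_n+n-1$. Let $\mu=\min\{e_i : k(i)\neq 0\}$ and $$\iota=\max\big(\{n-i : 1\le i<n,\ k(i)\ne0,\ e_i=\mu\}\cup\{n : k(n)\neq0,\ e_n=\mu\}\big).$$ Then for some nonzero scalar $u\in\mathbb{F}_p$: $P(\mu,\iota)(d^K)=u\,d_{n,n}^{p^{m_n}}\,d^K$ if $\iota=n$, and $P(\mu,\iota)(d^K)=u\,d_{n,n}^{p^{m_{n-\iota}}}\,d^K\,d_{n,n-\iota}^{-p^{m_{n-\iota}}}$ if $\iota<n$.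
   Context: Let $p$ be a prime and $\mathbb{F}_p=\mathbb{Z}/p\mathbb{Z}$. The Dickson algebra $\mathbb{F}_p[y_1,\dots,y_n]^{GL_n(\mathbb{F}_p)}=\mathbb{F}_p[d_{n,1},\dots,d_{n,n}]$ is the polynomial algebra on the Dickson invariants $d_{n,i}$ (the coefficients, up to sign, of $\prod_{v\in \mathbb{F}_p\langle y_1,\dots,y_n\rangle}(X-v)=X^{p^n}+\sum_{i}(-1)^i d_{n,i}X^{p^{n-i}}$), with $|d_{n,i}|=2(p^n-p^{n-i})$ for $p$ odd ($|y_i|=2$) and $2^n-2^{n-i}$ for $p=2$ ($|y_i|=1$). The mod $p$ Steenrod algebra acts by reduced powers $P^r$ (for $p=2$, $P^r$ means $Sq^r$). Composites are applied right to left. For integers $c\ge0$, $1\le j\le c+1$: $P(c,j)=P^{p^{c-j+1}}\cdots P^{p^{c-1}}P^{p^{c}}$. *)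

theory Defs
  imports "HOL-Library.Poly_Mapping" "HOL-Computational_Algebra.Polynomial"
          "HOL-Computational_Algebra.Factorial_Ring"
begin

text \<open>Polynomials in the variables y_1, y_2, ... with coefficients in 'a:
  a polynomial is a finitely supported map from exponent vectors (monomials)
  to coefficients; multiplication is the convolution of Poly_Mapping.\<close>
type_synonym 'a mpoly = "(nat \<Rightarrow>\<^sub>0 nat) \<Rightarrow>\<^sub>0 'a"

definition mconst :: "'a::zero \<Rightarrow> 'a mpoly" where
  "mconst c = Poly_Mapping.single 0 c"

definition yvar :: "nat \<Rightarrow> 'a::{zero,one} mpoly" where
  "yvar i = Poly_Mapping.single (Poly_Mapping.single i 1) 1"

definition lin_span :: "nat \<Rightarrow> 'a::comm_ring_1 mpoly set" where
  "lin_span n = {(\<Sum>i\<in>{1..n}. mconst (c i) * yvar i) | c. True}"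

definition dickson_poly :: "nat \<Rightarrow> 'a::comm_ring_1 mpoly poly" where
  "dickson_poly n = (\<Prod>v\<in>lin_span n. [:- v, 1:])"

text \<open>Dickson invariant d_{n,i}: prod(X - v) = X^(p^n) + sum_i (-1)^i d_{n,i} X^(p^(n-i)).\<close>
definition dickson :: "nat \<Rightarrow> nat \<Rightarrow> nat \<Rightarrow> 'a::comm_ring_1 mpoly" where
  "dickson p n i = (-1) ^ i * coeff (dickson_poly n) (p ^ (n - i))"

text \<open>Reduced power P^r (Sq^r for p = 2) on the polynomial algebra, given on
  monomials by the Cartan formula and P^r(y^a) = binom(a,r) y^(a + r(p-1)),
  extended linearly.\<close>
definition stP :: "nat \<Rightarrow> nat \<Rightarrow> 'a::comm_ring_1 mpoly \<Rightarrow> 'a mpoly" where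
  "stP p r f = (\<Sum>\<alpha>\<in>Poly_Mapping.keys f. mconst (Poly_Mapping.lookup f \<alpha>) *
      (\<Sum>\<beta>\<in>{\<beta>::nat \<Rightarrow> nat. (\<forall>i. \<beta> i \<le> Poly_Mapping.lookup \<alpha> i) \<and> (\<Sum>i\<in>Poly_Mapping.keys \<alpha>. \<beta> i) = r}.
          of_nat (\<Prod>i\<in>Poly_Mapping.keys \<alpha>. Poly_Mapping.lookup \<alpha> i choose \<beta> i) *
          (\<Prod>i\<in>Poly_Mapping.keys \<alpha>. yvar i ^ (Poly_Mapping.lookup \<alpha> i + (p - 1) * \<beta> i))))"

fun stPcomp :: "nat \<Rightarrow> nat \<Rightarrow> nat \<Rightarrow> 'a::comm_ring_1 mpoly \<Rightarrow> 'a mpoly" where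
  "stPcomp p c 0 f = f"
| "stPcomp p c (Suc j) f = stP p (p ^ (c - j)) (stPcomp p c j f)"

end

theory Submission
  imports Defs "HOL-Computational_Algebra.Primes" "HOL-Library.FuncSet"
begin

text \<open>
  The total operation \<open>T = \<Sum>\<^sub>r P\<^sup>r t\<^sup>r\<close> is the ring homomorphism with \<open>T(y) = y + t y^p\<close> on linear
  forms. Applied to the Dickson polynomial \<open>f(X)\<close>, which is additive in \<open>X\<close>, it gives a polynomial
  \<open>F\<close> such that \<open>F(X + t X^p)\<close> vanishes on the span of the variables, and comparing with
  \<open>f\<close> yields the leading terms \<open>T(d\<^sub>i) = d\<^sub>i + d\<^sub>i\<^sub>+\<^sub>1 t^(p^(n-i-1)) + \<dots>\<close> for \<open>i < n\<close> and
  \<open>T(d\<^sub>n) = d\<^sub>n - d\<^sub>1 d\<^sub>n t^(p^(n-1)) + \<dots>\<close>. Leading terms obey the Leibniz rule and are compatible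
  with Frobenius, so \<open>P^(p^\<mu>)\<close> acts on \<open>d\<^sup>K\<close> as a derivation that moves exactly the factors with
  \<open>e\<^sub>i = \<mu>\<close>. Each later operation has smaller degree, hence fixes the untouched factors and pushes the
  moved factor \<open>d\<^sub>j^(p^m)\<close> to \<open>d\<^sub>j\<^sub>+\<^sub>1^(p^m)\<close>, until it reaches \<open>d\<^sub>n^(p^m)\<close>, which the next operation
  annihilates. Only the longest chain survives \<open>\<iota>\<close> steps.
\<close>

section \<open>Prime fields\<close>

lemma CHAR_eq_prime:
  assumes "prime p" "of_nat p = (0 :: 'b :: comm_ring_1)"
  shows "CHAR('b) = p"
proof -
  have "CHAR('b) dvd p" using assms(2) by (simp add: of_nat_eq_0_iff_char_dvd)
  moreover have "CHAR('b) \<noteq> Suc 0" using CHAR_not_1 by simp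
  ultimately show ?thesis using assms(1) by (auto simp: prime_nat_iff)
qed

text \<open>Translation by \<open>1\<close> permutes the ring, so the sum of all elements equals
  itself plus the cardinality.\<close>

lemma of_nat_card_eq_0: "of_nat (card (UNIV :: 'a set)) = (0 :: 'a :: {finite,ring_1})"
proof -
  have "(\<Sum>x\<in>UNIV. x :: 'a) = (\<Sum>x\<in>UNIV. x + 1)"
    by (rule sum.reindex_bij_witness[of _ "\<lambda>x. x + 1" "\<lambda>x. x - 1"]) auto
  then show ?thesis by (simp add: sum.distrib)
qed

text \<open>The field is known only through its cardinality, so its elements are first exhibited as
  the images of the naturals below \<open>p\<close>; the claim for these follows by induction with
  the freshman's dream.\<close>

lemma fermat_prime_field:
  assumes "prime p" "card (UNIV :: 'a set) = p"
  shows "(x :: 'a :: {finite,field}) ^ p = x"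
proof -
  have char: "CHAR('a) = p"
    using of_nat_card_eq_0[where 'a = 'a] assms by (intro CHAR_eq_prime) auto
  have "inj_on (of_nat :: nat \<Rightarrow> 'a) {..<p}"
  proof (rule linorder_inj_onI)
    fix i j assume ij: "i < j" "j \<in> {..<p}"
    show "(of_nat i :: 'a) \<noteq> of_nat j"
    proof
      assume "(of_nat i :: 'a) = of_nat j"
      then have "(of_nat (j - i) :: 'a) = 0" using ij by (simp add: of_nat_diff)
      then have "p dvd j - i" by (simp add: of_nat_eq_0_iff_char_dvd char)
      then show False using ij by (auto dest: dvd_imp_le)
    qed
  qed auto
  then have "card ((of_nat :: nat \<Rightarrow> 'a) ` {..<p}) = card (UNIV :: 'a set)"
    by (simp add: card_image assms)
  then have "(of_nat :: nat \<Rightarrow> 'a) ` {..<p} = UNIV"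
    by (intro card_subset_eq) auto
  then obtain k where k: "x = of_nat k" by blast
  have "(of_nat k :: 'a) ^ p = of_nat k"
  proof (induction k)
    case 0
    then show ?case using assms(1) by (simp add: prime_gt_0_nat)
  next
    case (Suc k)
    then show ?case using assms(1) by (simp add: freshmans_dream char)
  qed
  with k show ?thesis by simp
qed

section \<open>The total Steenrod operation\<close>

lemma mconst_add: "mconst (a + b) = mconst a + mconst b"
  by (simp add: mconst_def single_add)

lemma mconst_mult: "mconst (a * b) = mconst a * mconst b"
  by (simp add: mconst_def mult_single)

lemma mconst_0 [simp]: "mconst 0 = 0" and mconst_1 [simp]: "mconst 1 = 1"
  by (simp_all add: mconst_def)

lemma mconst_power: "mconst (a ^ k) = mconst a ^ k"
  by (induction k) (simp_all add: mconst_mult)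

lemma mconst_of_nat [simp]: "mconst (of_nat k) = of_nat k"
  by (simp add: mconst_def)

lemma mconst_uminus: "mconst (- a) = - mconst (a :: 'a :: comm_ring_1)"
  by (simp add: mconst_def single_uminus)

text \<open>The image of the monomial with exponents \<alpha> under y \<mapsto> y + t y^p. The outer
  polynomial variable is t throughout.\<close>

definition tmon :: "nat \<Rightarrow> (nat \<Rightarrow>\<^sub>0 nat) \<Rightarrow> 'a::comm_ring_1 mpoly poly" where
  "tmon p \<alpha> = (\<Prod>i\<in>Poly_Mapping.keys \<alpha>. [:yvar i, yvar i ^ p:] ^ Poly_Mapping.lookup \<alpha> i)"

text \<open>The total operation \<open>f \<mapsto> \<Sum>\<^sub>r P\<^sup>r(f) t\<^sup>r\<close>.\<close>
definition tot :: "nat \<Rightarrow> 'a::comm_ring_1 mpoly \<Rightarrow> 'a mpoly poly" where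
  "tot p f = (\<Sum>\<alpha>\<in>Poly_Mapping.keys f. [:mconst (Poly_Mapping.lookup f \<alpha>):] * tmon p \<alpha>)"

lemma tmon_superset:
  assumes "finite A" "Poly_Mapping.keys \<alpha> \<subseteq> A"
  shows "tmon p \<alpha> = (\<Prod>i\<in>A. [:yvar i, yvar i ^ p:] ^ Poly_Mapping.lookup \<alpha> i)"
  unfolding tmon_def using assms by (intro prod.mono_neutral_left) (auto simp: in_keys_iff)

lemma tmon_add: "tmon p (\<alpha> + \<beta>) = tmon p \<alpha> * tmon p \<beta>"
proof -
  let ?A = "Poly_Mapping.keys \<alpha> \<union> Poly_Mapping.keys \<beta>"
  have "Poly_Mapping.keys (\<alpha> + \<beta>) \<subseteq> ?A" by (rule keys_add)
  then show ?thesis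
    by (subst (1 2 3) tmon_superset[of ?A])
       (auto simp: lookup_add power_add prod.distrib)
qed

lemma tot_superset:
  assumes "finite A" "Poly_Mapping.keys f \<subseteq> A"
  shows "tot p f = (\<Sum>\<alpha>\<in>A. [:mconst (Poly_Mapping.lookup f \<alpha>):] * tmon p \<alpha>)"
  unfolding tot_def using assms by (intro sum.mono_neutral_left) (auto simp: in_keys_iff)

lemma tot_add: "tot p (f + g) = tot p f + tot p g"
proof -
  let ?A = "Poly_Mapping.keys f \<union> Poly_Mapping.keys g"
  have "Poly_Mapping.keys (f + g) \<subseteq> ?A" by (rule keys_add)
  then show ?thesis
    by (subst (1 2 3) tot_superset[of ?A])
       (auto simp: lookup_add mconst_add smult_add_left sum.distrib)
qed

lemma tot_0 [simp]: "tot p 0 = 0"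
  by (simp add: tot_def)

lemma tot_sum: "tot p (sum f A) = (\<Sum>x\<in>A. tot p (f x))"
  by (induction A rule: infinite_finite_induct) (simp_all add: tot_add)

lemma tot_single: "tot p (Poly_Mapping.single \<alpha> c) = [:mconst c:] * tmon p \<alpha>"
  by (simp add: tot_superset[of "{\<alpha>}"])

lemma sum_singles: "(\<Sum>\<alpha>\<in>Poly_Mapping.keys f. Poly_Mapping.single \<alpha> (Poly_Mapping.lookup f \<alpha>)) = f"
  for f :: "'b \<Rightarrow>\<^sub>0 'c::comm_monoid_add"
proof (rule poly_mapping_eqI)
  fix k
  show "Poly_Mapping.lookup (\<Sum>\<alpha>\<in>Poly_Mapping.keys f. Poly_Mapping.single \<alpha> (Poly_Mapping.lookup f \<alpha>)) k =
        Poly_Mapping.lookup f k"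
    by (simp add: lookup_sum lookup_single when_def in_keys_iff)
qed

text \<open>The Cartan formula: \<open>tmon\<close> turns sums of exponents into products, and both
  sides are bilinear in the monomials.\<close>

lemma tot_mult: "tot p (f * g) = tot p f * tot p g"
proof -
  let ?s = "\<lambda>h \<alpha>. Poly_Mapping.single \<alpha> (Poly_Mapping.lookup h \<alpha>)"
  have "tot p (f * g) = tot p (\<Sum>\<alpha>\<in>Poly_Mapping.keys f. \<Sum>\<beta>\<in>Poly_Mapping.keys g. ?s f \<alpha> * ?s g \<beta>)"
    by (simp only: sum_singles flip: sum_product)
  also have "\<dots> = (\<Sum>\<alpha>\<in>Poly_Mapping.keys f. \<Sum>\<beta>\<in>Poly_Mapping.keys g.
      ([:mconst (Poly_Mapping.lookup f \<alpha>):] * tmon p \<alpha>) * ([:mconst (Poly_Mapping.lookup g \<beta>):] * tmon p \<beta>))"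
    by (simp add: tot_sum mult_single tot_single tmon_add mconst_mult mult_ac)
  also have "\<dots> = tot p f * tot p g"
    by (simp only: tot_def sum_product)
  finally show ?thesis .
qed

lemma tot_mconst [simp]: "tot p (mconst c) = [:mconst c:]"
  by (simp add: tot_single tmon_def mconst_def)

lemma tot_1 [simp]: "tot p 1 = 1"
  using tot_mconst[of p 1] by (simp del: tot_mconst add: one_pCons)

lemma tot_power: "tot p (f ^ k) = tot p f ^ k"
  by (induction k) (simp_all add: tot_mult)

lemma tot_yvar [simp]: "tot p (yvar i) = [:yvar i, yvar i ^ p:]"
  by (simp add: yvar_def tot_single tmon_def)

lemma single_prod:
  "Poly_Mapping.single (\<Sum>i\<in>A. f i) 1 = (\<Prod>i\<in>A. Poly_Mapping.single (f i) 1 :: 'a :: comm_ring_1 mpoly)"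
proof (induction A rule: infinite_finite_induct)
  case (insert x A)
  then show ?case by (simp flip: insert.IH add: mult_single)
qed simp_all

lemma yvar_power: "(yvar i :: 'a :: comm_ring_1 mpoly) ^ k = Poly_Mapping.single (Poly_Mapping.single i k) 1"
  by (induction k) (simp_all add: yvar_def mult_single flip: single_add)

lemma prod_yvar_power:
  "(\<Prod>i\<in>Poly_Mapping.keys \<alpha>. yvar i ^ Poly_Mapping.lookup \<alpha> i) =
   (Poly_Mapping.single \<alpha> 1 :: 'a :: comm_ring_1 mpoly)"
  by (simp add: yvar_power sum_singles flip: single_prod)

lemma coeff_0_tot [simp]: "coeff (tot p f) 0 = f"
proof -
  have "coeff (tmon p \<alpha>) 0 = (Poly_Mapping.single \<alpha> 1 :: 'a mpoly)" for \<alpha>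
    by (simp add: tmon_def poly_prod flip: poly_0_coeff_0 prod_yvar_power)
  then have "coeff (tot p f) 0 =
      (\<Sum>\<alpha>\<in>Poly_Mapping.keys f. Poly_Mapping.single \<alpha> (Poly_Mapping.lookup f \<alpha>))"
    by (simp add: tot_def coeff_sum mconst_def mult_single)
  then show ?thesis by (simp add: sum_singles)
qed

section \<open>Coefficients of the total operation as reduced powers\<close>

lemma linear_power_expand:
  fixes y :: "'b :: comm_ring_1"
  assumes "p > 0"
  shows "[:y, y ^ p:] ^ a = (\<Sum>b\<le>a. monom (of_nat (a choose b) * y ^ (a + (p - 1) * b)) b)"
proof -
  have "[:y, y ^ p:] = monom (y ^ p) 1 + [:y:]" by (simp add: monom_altdef)
  then have "[:y, y ^ p:] ^ a = (\<Sum>b\<le>a. of_nat (a choose b) * monom (y ^ p) 1 ^ b * [:y:] ^ (a - b))"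
    by (simp add: binomial_ring)
  also have "\<dots> = (\<Sum>b\<le>a. monom (of_nat (a choose b) * y ^ (a + (p - 1) * b)) b)"
  proof (rule sum.cong)
    fix b assume b: "b \<in> {..a}"
    \<comment> \<open>Both subtractions are genuine, since \<open>p > 0\<close> and \<open>b\<close>
      is at most \<open>a\<close>.\<close>
    have "a + (p - 1) * b = p * b + (a - b)"
      using b assms by (cases p) auto
    then show "of_nat (a choose b) * monom (y ^ p) 1 ^ b * [:y:] ^ (a - b) =
          monom (of_nat (a choose b) * y ^ (a + (p - 1) * b)) b"
      by (simp add: monom_power power_add power_mult of_nat_poly smult_monom mult_ac flip: monom_0)
         (simp add: mult_monom monom_0 smult_monom mult_ac flip: power_mult)
  qed simp
  finally show ?thesis .
qed

lemma prod_monom: "(\<Prod>i\<in>A. monom (f i) (g i)) = monom (prod f A) (sum g A)"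
  by (induction A rule: infinite_finite_induct) (simp_all add: mult_monom)

text \<open>Expanding the product of binomial sums chooses one exponent of t per variable;
  collecting the choices of total \<open>r\<close> gives the formula in \<open>stP\<close>.\<close>

lemma coeff_tmon:
  assumes "p > 0"
  shows "coeff (tmon p \<alpha> :: 'a::comm_ring_1 mpoly poly) r =
    (\<Sum>\<beta>\<in>{\<beta>::nat \<Rightarrow> nat. (\<forall>i. \<beta> i \<le> Poly_Mapping.lookup \<alpha> i) \<and> (\<Sum>i\<in>Poly_Mapping.keys \<alpha>. \<beta> i) = r}.
          of_nat (\<Prod>i\<in>Poly_Mapping.keys \<alpha>. Poly_Mapping.lookup \<alpha> i choose \<beta> i) *
          (\<Prod>i\<in>Poly_Mapping.keys \<alpha>. yvar i ^ (Poly_Mapping.lookup \<alpha> i + (p - 1) * \<beta> i)))"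
    (is "_ = sum ?F ?S")
proof -
  let ?K = "Poly_Mapping.keys \<alpha>" and ?a = "Poly_Mapping.lookup \<alpha>"
  let ?P = "PiE ?K (\<lambda>i. {..?a i})"
  have fin: "finite ?P" by (intro finite_PiE) auto
  have "tmon p \<alpha> = (\<Prod>i\<in>?K. \<Sum>b\<le>?a i. monom (of_nat (?a i choose b) * yvar i ^ (?a i + (p - 1) * b)) b
                   :: 'a mpoly poly)"
    by (simp add: tmon_def linear_power_expand assms)
  also have "\<dots> = (\<Sum>\<beta>\<in>?P. monom (?F \<beta>) (\<Sum>i\<in>?K. \<beta> i))"
    by (subst prod_sum_PiE) (simp_all add: prod_monom prod.distrib)
  finally have "coeff (tmon p \<alpha> :: 'a mpoly poly) r = (\<Sum>\<beta>\<in>?P. if (\<Sum>i\<in>?K. \<beta> i) = r then ?F \<beta> else 0)"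
    by (simp only: coeff_sum coeff_monom)
  also have "\<dots> = (\<Sum>\<beta>\<in>{\<beta>\<in>?P. (\<Sum>i\<in>?K. \<beta> i) = r}. ?F \<beta>)"
    using fin by (simp add: sum.If_cases Int_def)
  also have "\<dots> = sum ?F ?S"
  \<comment> \<open>Extensional functions on the keys are matched with functions that are
    \<open>0\<close> off the keys, where the bound by \<alpha> forces this value.\<close>
  proof (rule sum.reindex_bij_witness[of _ "\<lambda>\<beta>. restrict \<beta> ?K" "\<lambda>\<beta> i. if i \<in> ?K then \<beta> i else 0"])
    fix \<beta> assume "\<beta> \<in> ?S"
    then have "\<beta> i = 0" if "i \<notin> ?K" for i
      using that by (metis (mono_tags, lifting) in_keys_iff le_zero_eq mem_Collect_eq)
    then show "(\<lambda>i. if i \<in> ?K then restrict \<beta> ?K i else 0) = \<beta>" by auto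
  qed (auto simp: PiE_def Pi_def extensional_def cong: sum.cong prod.cong)
  finally show ?thesis .
qed

lemma coeff_tot: "p > 0 \<Longrightarrow> coeff (tot p f) r = stP p r f"
  by (simp add: tot_def coeff_sum stP_def coeff_tmon)

section \<open>The Dickson polynomial\<close>

text \<open>Bookkeeping for adding a \<open>p\<close>-polynomial to one whose coefficients were
  shifted up by a Frobenius.\<close>

lemma sum_atMost_Suc_shift_cond:
  "(\<Sum>j\<le>Suc n. (if j > 0 then f (j - 1) else 0) + (if j \<le> n then g j else (0::'b::comm_monoid_add))) =
   (\<Sum>j\<le>n. f j) + (\<Sum>j\<le>n. g j)"
proof -
  have "(\<Sum>j\<le>Suc n. if j > 0 then f (j - 1) else 0) = (\<Sum>j\<le>n. f j)"
    by (subst sum.atMost_Suc_shift) simp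
  moreover have "(\<Sum>j\<le>Suc n. if j \<le> n then g j else 0) = (\<Sum>j\<le>n. g j)"
    by simp
  ultimately show ?thesis by (simp only: sum.distrib)
qed

lemma lin_span_Suc:
  assumes "v \<in> lin_span (Suc n)"
  obtains w c where "w \<in> lin_span n" "v = w + mconst c * yvar (Suc n)"
  using assms by (auto simp: lin_span_def)

text \<open>The coefficients of a linear form can be read off at the monomials of degree one, so
  distinct coefficient vectors give distinct forms.\<close>

lemma card_lin_span: "card (lin_span n :: 'a::{finite,field} mpoly set) = card (UNIV :: 'a set) ^ n"
proof -
  let ?L = "\<lambda>c. \<Sum>i\<in>{1..n}. mconst (c i :: 'a) * yvar i"
  have lk: "Poly_Mapping.lookup (?L c) (Poly_Mapping.single i 1) = c i" if "i \<in> {1..n}" for c i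
  proof -
    have *: "(Poly_Mapping.single j (1::nat) = Poly_Mapping.single i 1) = (j = i)" for j
      by (metis lookup_single_eq lookup_single_not_eq zero_neq_one)
    have "?L c = (\<Sum>j\<in>{1..n}. Poly_Mapping.single (Poly_Mapping.single j 1) (c j))"
      by (simp add: mconst_def yvar_def mult_single)
    then show ?thesis using that * by (simp add: lookup_sum lookup_single when_def)
  qed
  have "lin_span n = ?L ` (PiE {1..n} (\<lambda>_. UNIV))"
  proof (intro equalityI subsetI)
    fix v :: "'a mpoly" assume "v \<in> lin_span n"
    then obtain c where "v = ?L c" by (auto simp: lin_span_def)
    then have "v = ?L (restrict c {1..n})" by simp
    then show "v \<in> ?L ` (PiE {1..n} (\<lambda>_. UNIV))"
      by (rule image_eqI[where x = "restrict c {1..n}"]) simp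
  next
    fix v :: "'a mpoly" assume "v \<in> ?L ` (PiE {1..n} (\<lambda>_. UNIV))"
    then show "v \<in> lin_span n" unfolding lin_span_def by blast
  qed
  moreover have "inj_on ?L (PiE {1..n} (\<lambda>_. UNIV))"
  proof (rule inj_onI)
    fix c d assume cd: "c \<in> PiE {1..n} (\<lambda>_. UNIV)" "d \<in> PiE {1..n} (\<lambda>_. UNIV)" "?L c = ?L d"
    show "c = d"
    proof (rule PiE_ext[OF cd(1,2)])
      fix i assume "i \<in> {1..n}"
      then show "c i = d i" using lk[of i c] lk[of i d] cd(3) by simp
    qed
  qed
  ultimately show ?thesis by (simp add: card_image card_PiE)
qed

lemma finite_lin_span: "finite (lin_span n :: 'a::{finite,field} mpoly set)"
  by (rule card_ge_0_finite) (simp add: card_lin_span finite_UNIV_card_ge_0)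

lemma poly_dickson_poly_root:
  assumes "v \<in> lin_span n"
  shows "poly (dickson_poly n) v = (0 :: 'a::{finite,field} mpoly)"
  unfolding dickson_poly_def poly_prod
  by (rule prod_zero[OF finite_lin_span]) (use assms in auto)

text \<open>For \<open>j \<le> n\<close> this is the Dickson invariant of index \<open>n - j\<close>
  up to sign, indexed by the Frobenius exponent of X.\<close>

definition pcoef :: "nat \<Rightarrow> nat \<Rightarrow> nat \<Rightarrow> 'a::comm_ring_1 mpoly" where
  "pcoef p n j = coeff (dickson_poly n) (p ^ j)"

context
  fixes p :: nat
  assumes p: "prime p" and card: "card (UNIV :: 'a::{finite,field} set) = p"
begin

lemma p_gt_0: "p > 0"
  using p by (simp add: prime_gt_0_nat)

lemma of_nat_p: "of_nat p = (0 :: 'a)"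
  using of_nat_card_eq_0[where 'a = 'a] card by simp

lemma CHAR_mpoly: "CHAR('a mpoly) = p"
  by (rule CHAR_eq_prime[OF p]) (metis mconst_0 mconst_of_nat of_nat_p)

lemma CHAR_mpoly_poly: "CHAR('a mpoly poly) = p"
  by (rule CHAR_eq_prime[OF p]) (metis CHAR_mpoly of_nat_CHAR of_nat_poly pCons_0_0)

lemma freshman_mpoly: "(x + y :: 'a mpoly) ^ (p ^ j) = x ^ (p ^ j) + y ^ (p ^ j)"
  by (rule freshmans_dream'[where n = j]) (use p CHAR_mpoly in simp_all)

lemma freshman_mpoly_poly: "(x + y :: 'a mpoly poly) ^ (p ^ j) = x ^ (p ^ j) + y ^ (p ^ j)"
  by (rule freshmans_dream'[where n = j]) (use p CHAR_mpoly_poly in simp_all)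

lemma freshman_sum_mpoly: "(sum f A :: 'a mpoly) ^ p = (\<Sum>x\<in>A. f x ^ p)"
  by (rule freshmans_dream_sum) (use p CHAR_mpoly in simp_all)

lemma mconst_power_p_power: "mconst (c :: 'a) ^ (p ^ j) = mconst c"
proof (induction j)
  case (Suc j)
  have "mconst c ^ (p ^ Suc j) = (mconst c ^ p ^ j) ^ p"
    by (simp add: mult.commute flip: power_mult)
  also have "\<dots> = mconst (c ^ p)"
    by (simp only: Suc.IH mconst_power)
  finally show ?case
    by (simp only: fermat_prime_field[OF p card])
qed simp

text \<open>The \<open>p\<close>-polynomial of the span is built by
  \<open>f\<^sub>n\<^sub>+\<^sub>1 = f\<^sub>n\<^sup>p - w\<^sup>p\<^sup>-\<^sup>1 f\<^sub>n\<close> with \<open>w = f\<^sub>n(y\<^sub>n\<^sub>+\<^sub>1)\<close>.\<close>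
lemma ex_p_polynomial:
  "\<exists>c. c n = 1 \<and> (\<forall>v\<in>lin_span n. (\<Sum>j\<le>n. c j * v ^ (p ^ j)) = (0 :: 'a mpoly))"
proof (induction n)
  case 0
  show ?case by (intro exI[of _ "\<lambda>_. 1"]) (auto simp: lin_span_def)
next
  case (Suc n)
  then obtain c where c: "c n = 1" "\<And>v. v \<in> lin_span n \<Longrightarrow> (\<Sum>j\<le>n. c j * v ^ (p ^ j)) = (0 :: 'a mpoly)"
    by blast
  define L where "L x = (\<Sum>j\<le>n. c j * x ^ (p ^ j))" for x
  define w where "w = L (yvar (Suc n))"
  define c' where "c' j = (if j > 0 then c (j - 1) ^ p else 0) +
                          (if j \<le> n then - (w ^ (p - 1) * c j) else 0)" for j
  have L': "(\<Sum>j\<le>Suc n. c' j * x ^ (p ^ j)) = L x ^ p - w ^ (p - 1) * L x" for x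
  proof -
    have "(\<Sum>j\<le>Suc n. c' j * x ^ (p ^ j)) =
      (\<Sum>j\<le>Suc n. (if j > 0 then (c (j - 1) * x ^ (p ^ (j - 1))) ^ p else 0) +
                   (if j \<le> n then - (w ^ (p - 1) * (c j * x ^ (p ^ j))) else 0))"
    proof (rule sum.cong)
      fix j
      show "c' j * x ^ (p ^ j) = (if j > 0 then (c (j - 1) * x ^ (p ^ (j - 1))) ^ p else 0) +
                   (if j \<le> n then - (w ^ (p - 1) * (c j * x ^ (p ^ j))) else 0)"
        by (cases j) (simp_all add: c'_def distrib_right right_diff_distrib left_diff_distrib power_mult_distrib mult_ac flip: power_mult)
    qed simp
    also have "\<dots> = (\<Sum>j\<le>n. (c j * x ^ (p ^ j)) ^ p) + (\<Sum>j\<le>n. - (w ^ (p - 1) * (c j * x ^ (p ^ j))))"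
      by (rule sum_atMost_Suc_shift_cond)
    finally show ?thesis
      by (simp add: L_def freshman_sum_mpoly sum_negf sum_distrib_left)
  qed
  have "(\<Sum>j\<le>Suc n. c' j * v ^ (p ^ j)) = 0" if v: "v \<in> lin_span (Suc n)" for v
  proof -
    obtain u b where u: "u \<in> lin_span n" "v = u + mconst b * yvar (Suc n)"
      using lin_span_Suc[OF v] by metis
    \<comment> \<open>\<open>L\<close> is additive, and linear over the prime field because scalars
      are fixed by Frobenius.\<close>
    have "L v = L u + mconst b * w"
      by (simp add: L_def u w_def freshman_mpoly power_mult_distrib mconst_power_p_power
                    algebra_simps sum.distrib sum_distrib_left)
    then have Lv: "L v = mconst b * w" using c(2)[OF u(1)] by (simp add: L_def)
    \<comment> \<open>Hence every scalar multiple \<open>b w\<close> is a root of z^p - w^(p-1)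
      z.\<close>
    have "w ^ p = w ^ (p - 1) * w" using p_gt_0 by (metis power_minus_mult)
    then show ?thesis
      unfolding L' Lv using mconst_power_p_power[of b 1] by (simp add: power_mult_distrib)
  qed
  moreover have "c' (Suc n) = 1" by (simp add: c'_def c(1))
  ultimately show ?case by blast
qed

section \<open>The Dickson polynomial as a \<open>p\<close>-polynomial\<close>

text \<open>The difference has degree below \<open>p ^ n\<close> but vanishes at the
  \<open>p ^ n\<close> elements of the span.\<close>

lemma lin_span_roots_eqI:
  fixes f g :: "'a mpoly poly"
  assumes "coeff f (p ^ n) = coeff g (p ^ n)" "degree f \<le> p ^ n" "degree g \<le> p ^ n"
    and "\<And>v. v \<in> lin_span n \<Longrightarrow> poly f v = poly g v"
  shows "f = g"
  by (rule poly_eqI_degree_lead_coeff[of _ "p ^ n" _ "lin_span n"])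
     (use assms in \<open>simp_all add: card_lin_span card\<close>)

lemma degree_sum_monom_p_le:
  "degree (\<Sum>j\<le>n. monom (c j) (p ^ j)) \<le> p ^ n"
proof (rule degree_sum_le)
  fix j assume "j \<in> {..n}"
  then have "p ^ j \<le> p ^ n" using p_gt_0 by (intro power_increasing) auto
  then show "degree (monom (c j) (p ^ j)) \<le> p ^ n"
    using degree_monom_le order_trans by blast
qed simp

lemma coeff_sum_monom_p:
  "coeff (\<Sum>j\<le>n. monom (c j) (p ^ j)) (p ^ i) = (if i \<le> n then c i else 0)"
proof -
  have "(p ^ j = p ^ i) = (j = i)" for j
    using prime_gt_1_nat[OF p] by (rule power_inject_exp)
  then show ?thesis by (simp add: coeff_sum)
qed

text \<open>The product over the span and the polynomial from \<open>ex_p_polynomial\<close> are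
  both monic of degree \<open>p ^ n\<close> and vanish on the span, so they coincide.\<close>

lemma dickson_poly_ex:
  "\<exists>c. c n = 1 \<and> (dickson_poly n :: 'a mpoly poly) = (\<Sum>j\<le>n. monom (c j) (p ^ j))"
proof -
  obtain c where c: "c n = 1" "\<And>v. v \<in> lin_span n \<Longrightarrow> (\<Sum>j\<le>n. c j * v ^ (p ^ j)) = (0 :: 'a mpoly)"
    using ex_p_polynomial by blast
  have deg: "degree (dickson_poly n :: 'a mpoly poly) = p ^ n"
    unfolding dickson_poly_def
    by (subst degree_prod_sum_eq) (simp_all add: card_lin_span card)
  have monic: "lead_coeff (dickson_poly n :: 'a mpoly poly) = 1"
    unfolding dickson_poly_def by (simp add: lead_coeff_prod)
  have "dickson_poly n = (\<Sum>j\<le>n. monom (c j) (p ^ j))"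
  proof (rule lin_span_roots_eqI)
    fix v :: "'a mpoly" assume v: "v \<in> lin_span n"
    have "poly (dickson_poly n) v = 0" using v by (rule poly_dickson_poly_root)
    then show "poly (dickson_poly n) v = poly (\<Sum>j\<le>n. monom (c j) (p ^ j)) v"
      using c(2)[OF v] by (simp add: poly_sum poly_monom)
  qed (use deg monic c(1) degree_sum_monom_p_le in \<open>auto simp: coeff_sum_monom_p\<close>)
  with c(1) show ?thesis by blast
qed

lemma pcoef_top: "pcoef p n n = (1 :: 'a mpoly)"
  using dickson_poly_ex[of n] by (auto simp: pcoef_def coeff_sum_monom_p)

lemma pcoef_root:
  assumes "v \<in> lin_span n"
  shows "(\<Sum>j\<le>n. pcoef p n j * v ^ (p ^ j)) = (0 :: 'a mpoly)"
proof -
  obtain c where c: "(dickson_poly n :: 'a mpoly poly) = (\<Sum>j\<le>n. monom (c j) (p ^ j))"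
    using dickson_poly_ex by blast
  have "poly (dickson_poly n) v = 0" using assms by (rule poly_dickson_poly_root)
  then show ?thesis by (simp add: pcoef_def c coeff_sum_monom_p poly_sum poly_monom)
qed

text \<open>The coefficients may now involve t, while the roots are the elements of the span,
  constant in t. With \<open>h n = 0\<close> the degree is too small for \<open>p ^ n\<close>
  roots.\<close>

lemma p_polynomial_vanishing:
  fixes h :: "nat \<Rightarrow> 'a mpoly poly"
  assumes "\<And>v. v \<in> lin_span n \<Longrightarrow> (\<Sum>j\<le>n. h j * [:v:] ^ (p ^ j)) = 0"
    and "h n = 0" "j \<le> n"
  shows "h j = 0"
proof -
  let ?H = "\<Sum>j\<le>n. monom (h j) (p ^ j)"
  have "card ((\<lambda>v. [:v:]) ` (lin_span n :: 'a mpoly set)) = p ^ n"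
    by (subst card_image) (auto simp: inj_on_def card_lin_span card)
  then have "?H = 0"
    by (intro poly_eqI_degree_lead_coeff[of _ "p ^ n" _ "(\<lambda>v. [:v:]) ` lin_span n"])
       (use assms degree_sum_monom_p_le in \<open>auto simp: coeff_sum_monom_p poly_sum poly_monom\<close>)
  then have "coeff ?H (p ^ j) = 0" by simp
  then show ?thesis using assms(3) by (simp add: coeff_sum_monom_p)
qed

end

section \<open>Leading terms of the total operation\<close>

text \<open>For positive \<open>N\<close> and \<open>p\<close> this says that P^r x = 0 for 0 < r <
  N and P^N x = y. The value y = 0 is allowed.\<close>

definition jet :: "nat \<Rightarrow> nat \<Rightarrow> 'a::comm_ring_1 mpoly \<Rightarrow> 'a mpoly \<Rightarrow> bool" where
  "jet p N x y \<longleftrightarrow> (\<exists>q. tot p x = [:x:] + [:0, 1:] ^ N * [:y:] + [:0, 1:] ^ Suc N * q)"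

lemma coeff_t_power_mult:
  "coeff ([:0, 1:] ^ k * q) r = (if k \<le> r then coeff q (r - k) else (0 :: 'b :: comm_ring_1))"
  by (simp add: coeff_monom_mult flip: monom_altdef[of 1, simplified])

lemma jet_imp_stP:
  assumes "jet p N x y" "N > 0" "p > 0"
  shows "stP p N x = y"
proof -
  obtain q where "tot p x = [:x:] + [:0, 1:] ^ N * [:y:] + [:0, 1:] ^ Suc N * q"
    using assms(1) by (auto simp: jet_def)
  then have "coeff (tot p x) N = y"
    using assms(2) by (simp only: coeff_add coeff_t_power_mult) (simp add: coeff_pCons split: nat.splits)
  then show ?thesis using assms(3) by (simp add: coeff_tot)
qed

lemma tot_eq_head: "\<exists>q. tot p x = [:x:] + [:0, 1:] * q"
proof -
  obtain a q where "tot p x = pCons a q" by (cases "tot p x")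
  then show ?thesis using coeff_0_tot[of p x] by (intro exI[of _ q]) auto
qed

lemma jet_add: "jet p N x y \<Longrightarrow> jet p N x' y' \<Longrightarrow> jet p N (x + x') (y + y')"
proof -
  assume "jet p N x y" "jet p N x' y'"
  then obtain q q' where
      "tot p x = [:x:] + [:0, 1:] ^ N * [:y:] + [:0, 1:] ^ Suc N * q"
      "tot p x' = [:x':] + [:0, 1:] ^ N * [:y':] + [:0, 1:] ^ Suc N * q'"
    by (auto simp: jet_def)
  moreover have "[:x + x':] = [:x:] + [:x':]" "[:y + y':] = [:y:] + [:y':]" by simp_all
  ultimately have "tot p (x + x') = [:x + x':] + [:0, 1:] ^ N * [:y + y':] + [:0, 1:] ^ Suc N * (q + q')"
    by (simp only: tot_add distrib_left add_ac)
  then show ?thesis by (auto simp only: jet_def)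
qed

lemma jet_0: "jet p N 0 0"
  unfolding jet_def by (rule exI[of _ 0]) simp

lemma jet_sum: "(\<And>i. i \<in> A \<Longrightarrow> jet p N (x i) (y i)) \<Longrightarrow> jet p N (sum x A) (sum y A)"
  by (induction A rule: infinite_finite_induct) (auto intro: jet_0 jet_add)

lemma jet_mconst: "jet p N (mconst c) 0"
  unfolding jet_def by (rule exI[of _ 0]) simp

lemma jet_mult:
  assumes "jet p N x y" "jet p N x' y'" "N > 0"
  shows "jet p N (x * x') (x * y' + x' * y)"
proof -
  define t :: "'a mpoly poly" where "t = [:0, 1:]"
  obtain q q' where q:
      "tot p x = [:x:] + t ^ N * [:y:] + t ^ Suc N * q"
      "tot p x' = [:x':] + t ^ N * [:y':] + t ^ Suc N * q'"
    using assms(1,2) by (auto simp: jet_def t_def)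
  \<comment> \<open>Positivity of \<open>N\<close> puts the cross term into the remainder:
    \<open>t ^ N * t ^ N = t ^ Suc N * t ^ M\<close>.\<close>
  obtain M where N: "N = Suc M" using assms(3) gr0_implies_Suc by blast
  have hom: "[:x * x':] = [:x:] * [:x':]" "[:x * y' + x' * y:] = [:x:] * [:y':] + [:x':] * [:y:]"
    by simp_all
  have alg: "(X + t ^ N * Y + t ^ Suc N * q) * (X' + t ^ N * Y' + t ^ Suc N * q') =
     X * X' + t ^ N * (X * Y' + X' * Y) + t ^ Suc N *
       (X * q' + q * X' + t ^ M * (Y + t * q) * (Y' + t * q'))" for X X' Y Y'
    by (simp add: N algebra_simps)
  show ?thesis
    unfolding jet_def t_def[symmetric] tot_mult q hom alg by blast
qed

lemma jet_power:
  assumes "jet p N x y" "N > 0"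
  shows "jet p N (x ^ k) (of_nat k * x ^ (k - 1) * y)"
proof (induction k)
  case 0
  show ?case using jet_mconst[of p N 1] by simp
next
  case (Suc k)
  have "x * (of_nat k * x ^ (k - 1) * y) + x ^ k * y = of_nat (Suc k) * x ^ (Suc k - 1) * y"
    by (cases k) (simp_all add: algebra_simps)
  then show ?case using jet_mult[OF assms(1) Suc assms(2)] by simp
qed

lemma jet_prod:
  assumes "finite A" "\<And>i. i \<in> A \<Longrightarrow> jet p N (x i) (y i)" "N > 0"
  shows "jet p N (prod x A) (\<Sum>i\<in>A. y i * prod x (A - {i}))"
  using assms
proof (induction A rule: finite_induct)
  case empty
  show ?case using jet_mconst[of p N 1] by simp
next
  case (insert a A)
  have "(\<Sum>i\<in>insert a A. y i * prod x (insert a A - {i})) =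
        y a * prod x A + (\<Sum>i\<in>A. y i * prod x (insert a A - {i}))"
    using insert.hyps by simp
  also have "(\<Sum>i\<in>A. y i * prod x (insert a A - {i})) = (\<Sum>i\<in>A. y i * (x a * prod x (A - {i})))"
  proof (rule sum.cong)
    fix i assume i: "i \<in> A"
    then have "insert a A - {i} = insert a (A - {i})" using insert.hyps by auto
    then show "y i * prod x (insert a A - {i}) = y i * (x a * prod x (A - {i}))"
      using insert.hyps by simp
  qed simp
  finally have "(\<Sum>i\<in>insert a A. y i * prod x (insert a A - {i})) =
      x a * (\<Sum>i\<in>A. y i * prod x (A - {i})) + prod x A * y a"
    by (simp add: sum_distrib_left mult_ac add_ac)
  moreover have "jet p N (x a * prod x A) (x a * (\<Sum>i\<in>A. y i * prod x (A - {i})) + prod x A * y a)"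
    using insert by (intro jet_mult) auto
  ultimately show ?case using insert.hyps by (simp add: ac_simps)
qed

text \<open>The term of order \<open>N\<close> is absorbed into the remainder. Operations of smaller
  degree thus treat such an element as a constant.\<close>

lemma jet_lower:
  assumes "jet p N x y" "N' < N"
  shows "jet p N' x 0"
proof -
  define t :: "'a mpoly poly" where "t = [:0, 1:]"
  obtain q where q: "tot p x = [:x:] + t ^ N * [:y:] + t ^ Suc N * q"
    using assms(1) by (auto simp: jet_def t_def)
  have N: "N = Suc N' + (N - Suc N')" using assms(2) by simp
  have "tot p x = [:x:] + t ^ N' * [:0:] + t ^ Suc N' * (t ^ (N - Suc N') * ([:y:] + t * q))"
    unfolding q by (subst (1 2) N) (simp add: power_add algebra_simps)
  then show ?thesis unfolding jet_def t_def by blast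
qed

context
  fixes p :: nat
  assumes p: "prime p" and card: "card (UNIV :: 'a::{finite,field} set) = p"
begin

text \<open>By the freshman's dream, the power acts on each term of the expansion separately and
  multiplies exponents of t by \<open>p ^ m\<close>.\<close>

lemma jet_frobenius:
  assumes "jet p N x (y :: 'a mpoly)"
  shows "jet p (N * p ^ m) (x ^ p ^ m) (y ^ p ^ m)"
proof -
  note fr = freshman_mpoly_poly[OF p card]
  define t :: "'a mpoly poly" where "t = [:0, 1:]"
  define P where "P = p ^ m"
  have "P > 0" using p by (simp add: P_def prime_gt_0_nat)
  obtain q where q: "tot p x = [:x:] + t ^ N * [:y:] + t ^ Suc N * q"
    using assms by (auto simp: jet_def t_def)
  have "tot p (x ^ P) = [:x ^ P:] + (t ^ N) ^ P * [:y ^ P:] + (t ^ Suc N) ^ P * q ^ P"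
    by (simp only: tot_power q P_def fr power_mult_distrib poly_const_pow)
  also have "(t ^ Suc N) ^ P = t ^ Suc (N * P) * t ^ (P - 1)"
    using \<open>P > 0\<close> by (simp add: algebra_simps flip: power_mult power_add power_Suc)
  finally have "tot p (x ^ P) = [:x ^ P:] + t ^ (N * P) * [:y ^ P:] + t ^ Suc (N * P) * (t ^ (P - 1) * q ^ P)"
    by (simp add: power_mult mult_ac)
  then show ?thesis unfolding jet_def t_def P_def by blast
qed

text \<open>These are the coefficients of an identity between \<open>p\<close>-polynomials in \<open>X\<close> of degree at most
  \<open>p^n\<close> with equal leading coefficient, both vanishing on the span: on the left
  \<open>F(X + t X^p) - t^(p^n) f(X)^p\<close> with \<open>F\<close> the image of the Dickson polynomial \<open>f\<close> under \<open>tot\<close>,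
  on the right a multiple of \<open>f\<close>.\<close>
lemma tot_pcoef_relations:
  fixes n :: nat
  defines "t \<equiv> [:0, 1:] :: 'a mpoly poly"
  defines "c \<equiv> pcoef p n"
  defines "B \<equiv> \<lambda>j. (if j > 0 then t ^ (p ^ (j - 1)) * tot p (c (j - 1)) - t ^ (p ^ n) * [:c (j - 1):] ^ p else 0)
        + (if j \<le> n then tot p (c j) else 0)"
  assumes "j \<le> n"
  shows "B j = B n * [:c j:]"
proof -
  note fr = freshman_mpoly_poly[OF p card]
  note root = pcoef_root[OF p card]
  have cn: "c n = 1" using pcoef_top[OF p card] by (simp add: c_def)
  have B0: "(\<Sum>j\<le>n. B j * [:v:] ^ (p ^ j)) = 0" if v: "v \<in> lin_span n" for v
  proof -
    have tv: "tot p v = [:v:] + t * [:v:] ^ p"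
    proof -
      obtain b where b: "v = (\<Sum>i\<in>{1..n}. mconst (b i) * yvar i)"
        using v by (auto simp: lin_span_def)
      have vp: "v ^ p = (\<Sum>i\<in>{1..n}. mconst (b i) * yvar i ^ p)"
        using mconst_power_p_power[OF p card, where j = 1]
        by (simp add: b freshman_sum_mpoly[OF p card] power_mult_distrib)
      have "tot p v = (\<Sum>i\<in>{1..n}. [:mconst (b i) * yvar i:]) + t * (\<Sum>i\<in>{1..n}. [:mconst (b i) * yvar i ^ p:])"
        by (simp add: b tot_sum tot_mult t_def sum_distrib_left mult.commute flip: sum.distrib)
      also have "\<dots> = [:v:] + t * [:v ^ p:]"
        by (simp only: sum_to_poly flip: b vp)
      finally show ?thesis by (simp add: poly_const_pow)
    qed
    have tvp: "tot p (c j) * tot p v ^ (p ^ j) =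
        tot p (c j) * [:v:] ^ (p ^ j) + t ^ (p ^ j) * tot p (c j) * [:v:] ^ (p ^ Suc j)" for j
      unfolding tv fr power_mult_distrib power_Suc power_mult[symmetric] by (simp only: algebra_simps)
    have r1: "(\<Sum>j\<le>n. tot p (c j) * tot p v ^ (p ^ j)) = 0"
      using arg_cong[OF root[OF v], of "tot p"] by (simp add: c_def tot_sum tot_mult tot_power)
    \<comment> \<open>The \<open>p\<close>-th power of f(v) = 0.\<close>
    have r2: "(\<Sum>j\<le>n. [:c j:] ^ p * [:v:] ^ (p ^ Suc j)) = 0"
    proof -
      have "0 = [:\<Sum>j\<le>n. c j * v ^ (p ^ j):] ^ p"
        using root[OF v] p by (simp add: c_def prime_gt_0_nat)
      also have "\<dots> = [:\<Sum>j\<le>n. (c j) ^ p * v ^ (p ^ Suc j):]"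
        by (simp add: poly_const_pow freshman_sum_mpoly[OF p card] power_mult_distrib mult.commute flip: power_mult)
      finally show ?thesis by (simp add: poly_const_pow mult.commute flip: sum_to_poly)
    qed
    have "(\<Sum>j\<le>Suc n. B j * [:v:] ^ (p ^ j)) =
      (\<Sum>j\<le>Suc n. (if j > 0 then t ^ (p ^ (j - 1)) * tot p (c (j - 1)) * [:v:] ^ (p ^ Suc (j - 1))
                           - t ^ (p ^ n) * ([:c (j - 1):] ^ p * [:v:] ^ (p ^ Suc (j - 1))) else 0)
                + (if j \<le> n then tot p (c j) * [:v:] ^ (p ^ j) else 0))"
      by (rule sum.cong) (auto simp: B_def algebra_simps)
    also have "\<dots> = (\<Sum>j\<le>n. t ^ (p ^ j) * tot p (c j) * [:v:] ^ (p ^ Suc j)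
                           - t ^ (p ^ n) * ([:c j:] ^ p * [:v:] ^ (p ^ Suc j)))
                + (\<Sum>j\<le>n. tot p (c j) * [:v:] ^ (p ^ j))"
      by (rule sum_atMost_Suc_shift_cond)
    also have "\<dots> = (\<Sum>j\<le>n. tot p (c j) * tot p v ^ (p ^ j)) -
                       t ^ (p ^ n) * (\<Sum>j\<le>n. [:c j:] ^ p * [:v:] ^ (p ^ Suc j))"
      by (simp only: tvp sum_subtractf sum.distrib sum_distrib_left) (simp only: algebra_simps)
    also have "\<dots> = 0" by (simp only: r1 r2) simp
    finally have "(\<Sum>j\<le>Suc n. B j * [:v:] ^ (p ^ j)) = 0" .
    \<comment> \<open>The subtracted \<open>p\<close>-th power of f was scaled so that the terms of
      degree p^(n+1) in X cancel, since \<open>c n = 1\<close>.\<close>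
    moreover have "B (Suc n) = 0" by (simp add: B_def cn flip: one_pCons)
    ultimately show ?thesis by simp
  qed
  \<comment> \<open>Subtracting \<open>B n\<close> times f kills the coefficient of index
    \<open>n\<close> and keeps the roots.\<close>
  have "B j - B n * [:c j:] = 0"
  proof (rule p_polynomial_vanishing[OF p card])
    fix v :: "'a mpoly" assume v: "v \<in> lin_span n"
    have "(\<Sum>j\<le>n. [:c j:] * [:v:] ^ (p ^ j)) = [:\<Sum>j\<le>n. c j * v ^ (p ^ j):]"
      by (simp add: poly_const_pow mult.commute flip: sum_to_poly)
    also have "\<dots> = 0" using root[OF v] by (simp add: c_def)
    finally have "(\<Sum>j\<le>n. [:c j:] * [:v:] ^ (p ^ j)) = 0" .
    then have "(\<Sum>j\<le>n. B n * ([:c j:] * [:v:] ^ (p ^ j))) = 0"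
      by (simp only: mult_zero_right flip: sum_distrib_left)
    then show "(\<Sum>j\<le>n. (B j - B n * [:c j:]) * [:v:] ^ (p ^ j)) = 0"
      using B0[OF v] by (simp only: left_diff_distrib sum_subtractf mult.assoc diff_0_right)
  qed (use assms(4) cn in simp_all)
  then show ?thesis by simp
qed

end

section \<open>The action on Dickson invariants\<close>

lemma jet_mconst_mult:
  "jet p N x y \<Longrightarrow> N > 0 \<Longrightarrow> jet p N (mconst a * x) (mconst a * y)"
  using jet_mult[OF jet_mconst, of p N x y a] by simp

text \<open>The existential form records only the order below which a factor is left unmoved, which
  suffices for \<open>jet_lower\<close>.\<close>

lemma ex_jet_mult:
  "\<exists>y. jet p N x y \<Longrightarrow> \<exists>y. jet p N x' y \<Longrightarrow> N > 0 \<Longrightarrow> \<exists>y. jet p N (x * x') y"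
  by (blast intro: jet_mult)

lemma ex_jet_prod:
  "(\<And>i. i \<in> A \<Longrightarrow> \<exists>y. jet p N (x i) y) \<Longrightarrow> N > 0 \<Longrightarrow> \<exists>y. jet p N (prod x A) y"
proof (induction A rule: infinite_finite_induct)
  case (insert a A)
  then show ?case by (simp add: ex_jet_mult)
qed (use jet_mconst[of p N 1] in auto)

text \<open>The number of reduced powers leading from \<open>d\<^sub>i\<close> up to \<open>d\<^sub>n\<close>: for \<open>i < n\<close> the chain is
  \<open>d\<^sub>i, d\<^sub>i\<^sub>+\<^sub>1, \<dots>, d\<^sub>n\<close>, while \<open>d\<^sub>n\<close> itself first yields \<open>- d\<^sub>1 d\<^sub>n\<close> and the chain restarts at \<open>d\<^sub>1\<close>.\<close>
definition chain_len :: "nat \<Rightarrow> nat \<Rightarrow> nat" where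
  "chain_len n i = (if i < n then n - i else n)"

context
  fixes p :: nat
  assumes p: "prime p" and card: "card (UNIV :: 'a::{finite,field} set) = p"
begin

text \<open>At index \<open>0\<close> the shifted term is absent, so the relation reads T(c_0) = B_n
  c_0, and B_n = 1 + c_(n-1) t^(p^(n-1)) + higher terms.\<close>

lemma jet_pcoef_0:
  assumes "n > 0"
  shows "jet p (p ^ (n - 1)) (pcoef p n 0 :: 'a mpoly) (pcoef p n 0 * pcoef p n (n - 1))"
proof -
  define t :: "'a mpoly poly" where "t = [:0, 1:]"
  define N where "N = p ^ (n - 1)"
  let ?c = "pcoef p n :: nat \<Rightarrow> 'a mpoly"
  have "N < p ^ n" unfolding N_def using assms prime_gt_1_nat[OF p] by (intro power_strict_increasing) auto
  then obtain s where s: "p ^ n = Suc N + s" using less_eq_Suc_le le_Suc_ex by metis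
  obtain q where q: "tot p (?c (n - 1)) = [:?c (n - 1):] + t * q"
    using tot_eq_head unfolding t_def by blast
  have "tot p (?c 0) = (t ^ N * tot p (?c (n - 1)) - t ^ (p ^ n) * [:?c (n - 1):] ^ p + 1) * [:?c 0:]"
    using tot_pcoef_relations[OF p card, of 0 n] assms pcoef_top[OF p card]
    by (simp add: t_def N_def del: mult_pCons_right)
  also have "\<dots> = [:?c 0:] + t ^ N * ([:?c 0:] * [:?c (n - 1):])
      + t ^ Suc N * ((q - t ^ s * [:?c (n - 1):] ^ p) * [:?c 0:])"
    unfolding q s by (simp only: power_add power_Suc) algebra
  also have "[:?c 0:] * [:?c (n - 1):] = [:?c 0 * ?c (n - 1):]" by simp
  finally show ?thesis unfolding jet_def t_def N_def by blast
qed

text \<open>Solving the relation for T(c_j), the lowest correction is - t^(p^(j-1)) c_(j-1); the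
  factor B_n contributes only from order p^(n-1) on, which is larger because
  \<open>j < n\<close>.\<close>

lemma jet_pcoef:
  assumes "0 < j" "j < n"
  shows "jet p (p ^ (j - 1)) (pcoef p n j :: 'a mpoly) (- pcoef p n (j - 1))"
proof -
  define t :: "'a mpoly poly" where "t = [:0, 1:]"
  define N where "N = p ^ (j - 1)"
  let ?c = "pcoef p n :: nat \<Rightarrow> 'a mpoly"
  have "N < p ^ n" unfolding N_def using assms prime_gt_1_nat[OF p] by (intro power_strict_increasing) auto
  then obtain s where s: "p ^ n = Suc N + s" using less_eq_Suc_le le_Suc_ex by metis
  have "N < p ^ (n - 1)" unfolding N_def using assms prime_gt_1_nat[OF p] by (intro power_strict_increasing) auto
  then obtain s' where s': "p ^ (n - 1) = Suc N + s'" using less_eq_Suc_le le_Suc_ex by metis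
  obtain q where q: "tot p (?c (j - 1)) = [:?c (j - 1):] + t * q"
    using tot_eq_head unfolding t_def by blast
  have "t ^ N * tot p (?c (j - 1)) - t ^ (p ^ n) * [:?c (j - 1):] ^ p + tot p (?c j) =
     (t ^ (p ^ (n - 1)) * tot p (?c (n - 1)) - t ^ (p ^ n) * [:?c (n - 1):] ^ p + 1) * [:?c j:]"
    using tot_pcoef_relations[OF p card, of j n] assms pcoef_top[OF p card]
    by (simp add: t_def N_def del: mult_pCons_right)
  then have "tot p (?c j) =
     (t ^ (p ^ (n - 1)) * tot p (?c (n - 1)) - t ^ (p ^ n) * [:?c (n - 1):] ^ p + 1) * [:?c j:]
     - (t ^ N * tot p (?c (j - 1)) - t ^ (p ^ n) * [:?c (j - 1):] ^ p)"
    by (simp add: eq_diff_eq add.commute)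
  also have "\<dots> = [:?c j:] + t ^ N * (- [:?c (j - 1):])
      + t ^ Suc N * ((t ^ s' * tot p (?c (n - 1)) - t ^ s * [:?c (n - 1):] ^ p) * [:?c j:]
          - q + t ^ s * [:?c (j - 1):] ^ p)"
    unfolding q s s' by (simp only: power_add power_Suc) algebra
  also have "- [:?c (j - 1):] = [:- ?c (j - 1):]" by simp
  finally show ?thesis unfolding jet_def t_def N_def by blast
qed

lemma dickson_pcoef: "dickson p n i = mconst ((-1) ^ i) * (pcoef p n (n - i) :: 'a mpoly)"
  by (simp add: dickson_def pcoef_def mconst_power mconst_uminus)

text \<open>The alternating sign in the definition of \<open>dickson\<close> absorbs the minus sign
  of \<open>jet_pcoef\<close>.\<close>

lemma jet_dickson_less:
  assumes "1 \<le> i" "i < n"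
  shows "jet p (p ^ (n - i - 1)) (dickson p n i :: 'a mpoly) (dickson p n (i + 1))"
proof -
  have "jet p (p ^ (n - i - 1)) (mconst ((-1) ^ i) * pcoef p n (n - i) :: 'a mpoly)
          (mconst ((-1) ^ i) * - pcoef p n (n - i - 1))"
    using assms p by (intro jet_mconst_mult jet_pcoef) (auto simp: prime_gt_0_nat)
  then show ?thesis by (simp add: dickson_pcoef mconst_uminus)
qed

lemma jet_dickson_top:
  assumes "n > 0"
  shows "jet p (p ^ (n - 1)) (dickson p n n :: 'a mpoly) (- (dickson p n n * dickson p n 1))"
proof -
  have "jet p (p ^ (n - 1)) (mconst ((-1) ^ n) * pcoef p n 0 :: 'a mpoly)
          (mconst ((-1) ^ n) * (pcoef p n 0 * pcoef p n (n - 1)))"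
    using assms p by (intro jet_mconst_mult jet_pcoef_0) (auto simp: prime_gt_0_nat)
  then show ?thesis by (simp add: dickson_pcoef mconst_uminus mult_ac)
qed

text \<open>Both cases in one form: \<open>n - chain_len n i + 1\<close> is \<open>i + 1\<close> for
  \<open>i < n\<close> and \<open>1\<close> for \<open>i = n\<close>.\<close>

lemma jet_dickson:
  assumes "1 \<le> i" "i \<le> n"
  shows "jet p (p ^ (chain_len n i - 1)) (dickson p n i :: 'a mpoly)
    ((if i < n then 1 else - dickson p n n) * dickson p n (n - chain_len n i + 1))"
  using assms jet_dickson_less[of i n] jet_dickson_top[of n]
  by (cases "i < n") (auto simp: chain_len_def)

lemma jet_dickson_frobenius:
  assumes "1 \<le> i" "i \<le> n"
  shows "jet p (p ^ (m + chain_len n i - 1)) (dickson p n i ^ p ^ m :: 'a mpoly)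
    (((if i < n then 1 else - dickson p n n) * dickson p n (n - chain_len n i + 1)) ^ p ^ m)"
proof -
  have "chain_len n i \<ge> 1" using assms by (auto simp: chain_len_def)
  then have "p ^ (chain_len n i - 1) * p ^ m = p ^ (m + chain_len n i - 1)"
    by (simp add: add.commute flip: power_add)
  then show ?thesis using jet_frobenius[OF p card jet_dickson[OF assms], of m] by simp
qed

text \<open>Meant for cofactors, whose exponent is divisible by \<open>p ^ m\<close> but may have
  larger multiplicity or be \<open>0\<close>.\<close>

lemma ex_jet_dickson_power:
  assumes "1 \<le> i" "i \<le> n" "p ^ m dvd k"
  shows "\<exists>y. jet p (p ^ (m + chain_len n i - 1)) (dickson p n i ^ k :: 'a mpoly) y"
proof -
  obtain b where "k = p ^ m * b" using assms(3) by blast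
  then show ?thesis
    using jet_power[OF jet_dickson_frobenius[OF assms(1,2), of m], of b] p
    by (auto simp: power_mult prime_gt_0_nat)
qed

lemma mconst_minus_power: "(- x) ^ j = mconst ((-1) ^ j) * (x :: 'a mpoly) ^ j"
  unfolding mconst_power mconst_uminus mconst_1 by (rule power_minus)

text \<open>Write k = p^m b with b prime to p: the power rule for \<open>(d ^ p ^ m) ^ b\<close>
  produces the scalar b, nonzero in the field. For \<open>i = n\<close> the derivative contains
  \<open>d\<^sub>n ^ p ^ m\<close> again, so the full power survives; its sign goes into
  \<gamma>.\<close>

lemma jet_dickson_power:
  assumes "1 \<le> i" "i \<le> n" "k \<noteq> 0" and m: "m = multiplicity p k"
  shows "\<exists>\<gamma>::'a. \<gamma> \<noteq> 0 \<and> jet p (p ^ (m + chain_len n i - 1)) (dickson p n i ^ k)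
    (mconst \<gamma> * (if i < n then dickson p n i ^ (k - p ^ m) else dickson p n n ^ k) *
     dickson p n (n - chain_len n i + 1) ^ p ^ m)"
proof -
  obtain b where b: "k = p ^ m * b" "\<not> p dvd b"
    using assms(3) p unfolding m by (metis multiplicity_decompose' not_prime_unit)
  then have "b > 0" by (auto intro: Nat.gr0I)
  let ?d = "dickson p n i :: 'a mpoly" and ?s = "(-1) ^ p ^ m :: 'a"
  define V :: "'a mpoly" where "V = (if i < n then 1 else dickson p n n ^ p ^ m)"
  define \<gamma> where "\<gamma> = of_nat b * (if i < n then 1 else ?s)"
  have "CHAR('a) = p"
    using of_nat_p[OF p card] by (rule CHAR_eq_prime[OF p])
  then have "(of_nat b :: 'a) \<noteq> 0" using b(2) by (simp add: of_nat_eq_0_iff_char_dvd)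
  then have \<gamma>: "\<gamma> \<noteq> 0" by (simp add: \<gamma>_def)
  have "jet p (p ^ (m + chain_len n i - 1)) ((?d ^ p ^ m) ^ b) (of_nat b * (?d ^ p ^ m) ^ (b - 1) *
    (((if i < n then 1 else - dickson p n n) * dickson p n (n - chain_len n i + 1)) ^ p ^ m))"
    using p by (intro jet_power jet_dickson_frobenius assms) (auto simp: prime_gt_0_nat)
  also have "of_nat b * (?d ^ p ^ m) ^ (b - 1) *
    (((if i < n then 1 else - dickson p n n) * dickson p n (n - chain_len n i + 1)) ^ p ^ m) =
    mconst \<gamma> * ((?d ^ p ^ m) ^ (b - 1) * V) * dickson p n (n - chain_len n i + 1) ^ p ^ m"
    by (simp add: \<gamma>_def V_def mconst_mult power_mult_distrib mconst_minus_power mult_ac)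
  also have "(?d ^ p ^ m) ^ (b - 1) * V =
     (if i < n then dickson p n i ^ (k - p ^ m) else dickson p n n ^ k)"
  proof (cases "i < n")
    case True
    then show ?thesis by (simp add: V_def b(1) diff_mult_distrib2 flip: power_mult)
  next
    case False
    have "(?d ^ p ^ m) ^ (b - 1) * ?d ^ p ^ m = (?d ^ p ^ m) ^ b"
      using \<open>b > 0\<close> by (metis power_minus_mult)
    with False assms(2) show ?thesis by (simp add: V_def b(1) power_mult)
  qed
  also have "(?d ^ p ^ m) ^ b = ?d ^ k" by (simp add: b(1) power_mult)
  finally show ?thesis using \<gamma> by blast
qed

end

section \<open>Iterated operations on a Dickson monomial\<close>

text \<open>The first operation gives one summand per index in \<open>I\<close> by the Leibniz rule.
  Every later one acts only on the moved factor of each summand and raises its index by one, until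
  the chain ends and the summand vanishes.\<close>

lemma stPcomp_derivation_sum:
  fixes p n :: nat and k m :: "nat \<Rightarrow> nat" and dK :: "'a::{finite,field} mpoly"
  assumes p: "prime p" and card: "card (UNIV :: 'a set) = p"
    and dK: "dK = (\<Prod>i\<in>{1..n}. dickson p n i ^ k i)"
    and m: "\<And>i. m i = multiplicity p (k i)"
    and \<mu>_le: "\<And>i. i \<in> {1..n} \<Longrightarrow> k i \<noteq> 0 \<Longrightarrow> \<mu> \<le> m i + chain_len n i - 1"
    and I: "I = {i \<in> {1..n}. k i \<noteq> 0 \<and> m i + chain_len n i - 1 = \<mu>}"
  obtains \<gamma> :: "nat \<Rightarrow> 'a" where "\<And>i. \<gamma> i \<noteq> 0"
    "\<And>s. s \<le> \<mu> \<Longrightarrow> stPcomp p \<mu> (Suc s) dK = (\<Sum>i\<in>I. if Suc s \<le> chain_len n i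
        then mconst (\<gamma> i) * ((if i < n then dickson p n i ^ (k i - p ^ m i) else dickson p n n ^ k n) *
                (\<Prod>j\<in>{1..n}-{i}. dickson p n j ^ k j)) * dickson p n (n - chain_len n i + Suc s) ^ p ^ m i
        else 0)"
proof -
  define d :: "nat \<Rightarrow> 'a mpoly" where "d = dickson p n"
  define W where "W i = (if i < n then d i ^ (k i - p ^ m i) else d n ^ k n)" for i
  define R where "R i = (\<Prod>j\<in>{1..n}-{i}. d j ^ k j)" for i
  have pos: "p ^ j > 0" for j using p by (simp add: prime_gt_0_nat)
  have pm_dvd: "p ^ m i dvd k i" for i by (simp add: m multiplicity_dvd)
  have "\<exists>\<gamma>::'a. \<gamma> \<noteq> 0 \<and> (i \<in> {1..n} \<longrightarrow> k i \<noteq> 0 \<longrightarrow>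
    jet p (p ^ (m i + chain_len n i - 1)) (d i ^ k i) (mconst \<gamma> * W i * d (n - chain_len n i + 1) ^ p ^ m i))" for i
  proof (cases "i \<in> {1..n} \<and> k i \<noteq> 0")
    case True
    then show ?thesis
      using jet_dickson_power[OF p card, of i n "k i" "m i"] m by (auto simp: d_def W_def)
  next
    case False
    \<comment> \<open>The default \<open>1\<close> keeps \<gamma> nonzero at every index.\<close>
    then show ?thesis by (intro exI[of _ 1]) auto
  qed
  then obtain \<gamma> :: "nat \<Rightarrow> 'a" where \<gamma>: "\<And>i. \<gamma> i \<noteq> 0"
    "\<And>i. i \<in> {1..n} \<Longrightarrow> k i \<noteq> 0 \<Longrightarrow>
      jet p (p ^ (m i + chain_len n i - 1)) (d i ^ k i) (mconst (\<gamma> i) * W i * d (n - chain_len n i + 1) ^ p ^ m i)"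
    by metis
  \<comment> \<open>The summand of index \<open>i\<close> after \<open>s\<close> operations.\<close>
  define X where "X i s = (if s \<le> chain_len n i
     then mconst (\<gamma> i) * (W i * R i) * d (n - chain_len n i + s) ^ p ^ m i else 0)" for i s
  have chain_len_pos: "chain_len n i \<ge> 1" if "i \<in> {1..n}" for i using that by (auto simp: chain_len_def)
  have jet_factor: "jet p (p ^ \<mu>) (d i ^ k i)
      (if i \<in> I then mconst (\<gamma> i) * W i * d (n - chain_len n i + 1) ^ p ^ m i else 0)" if i: "i \<in> {1..n}" for i
  proof (cases "k i = 0")
    case True
    then show ?thesis using jet_mconst[of p _ 1] by (simp add: I)
  next
    case False
    show ?thesis
    proof (cases "i \<in> I")
      case True
      then show ?thesis using \<gamma>(2)[OF i False] by (simp add: I)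
    next
      case nI: False
      then have "\<mu> < m i + chain_len n i - 1" using \<mu>_le[OF i False] i False by (auto simp: I)
      then have "p ^ \<mu> < p ^ (m i + chain_len n i - 1)"
        using prime_gt_1_nat[OF p] by (intro power_strict_increasing) auto
      then show ?thesis using jet_lower[OF \<gamma>(2)[OF i False]] nI by simp
    qed
  qed
  have cofactor: "jet p (p ^ c) (W i * R i) 0" if i: "i \<in> I" and c: "c < \<mu>" for i c
  proof -
    have i': "i \<in> {1..n}" "k i \<noteq> 0" "m i + chain_len n i - 1 = \<mu>" using i by (auto simp: I)
    have "\<exists>y. jet p (p ^ \<mu>) (W i) y"
      \<comment> \<open>Subtracting \<open>p ^ m i\<close> from \<open>k i\<close> preserves
        divisibility by \<open>p ^ m i\<close>, so \<open>W i\<close> is still unmoved below order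
        \<open>p ^ \<mu>\<close>.\<close>
      using ex_jet_dickson_power[OF p card, of i n "m i"] i' pm_dvd[of i]
      by (cases "i < n") (auto simp: W_def d_def intro!: dvd_diff_nat)
    moreover have "\<exists>y. jet p (p ^ \<mu>) (R i) y"
      unfolding R_def using jet_factor pos by (intro ex_jet_prod) auto
    ultimately have "\<exists>y. jet p (p ^ \<mu>) (W i * R i) y" using pos by (rule ex_jet_mult)
    moreover have "p ^ c < p ^ \<mu>"
      using c prime_gt_1_nat[OF p] by (intro power_strict_increasing) auto
    ultimately show ?thesis using jet_lower by blast
  qed
  have jet_step: "jet p (p ^ (\<mu> - s)) (X i s) (X i (Suc s))"
    if i: "i \<in> I" and s: "0 < s" "s \<le> \<mu>" for i s
  proof -
    have i': "i \<in> {1..n}" "k i \<noteq> 0" "m i + chain_len n i - 1 = \<mu>" using i by (auto simp: I)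
    have cof: "jet p (p ^ (\<mu> - s)) (W i * R i) 0" using s by (intro cofactor[OF i]) auto
    have chain_len_le: "chain_len n i \<le> n" using i' by (auto simp: chain_len_def)
    show ?thesis
    proof (cases "s \<le> chain_len n i")
      case False
      then show ?thesis by (simp add: X_def jet_0)
    next
      case True
      define r where "r = n - chain_len n i + s"
      define y where "y = (if s < chain_len n i then d (Suc r) ^ p ^ m i else 0)"
      have "jet p (p ^ (\<mu> - s)) (d r ^ p ^ m i) y"
      proof (cases "s < chain_len n i")
        case True
        then have r: "1 \<le> r" "r < n" using s chain_len_le by (auto simp: r_def)
        have "chain_len n r = n - r" using r by (simp add: chain_len_def)
        also have "\<dots> = chain_len n i - s" using chain_len_le True by (simp add: r_def)
        \<comment> \<open>The operation now applied has exactly the degree that moves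
          \<open>d r ^ p ^ m i\<close> to the next invariant.\<close>
        finally have "m i + chain_len n r - 1 = \<mu> - s"
          using True i'(3) by simp
        moreover have "n - chain_len n r = r" using r by (simp add: chain_len_def)
        ultimately show ?thesis
          using jet_dickson_frobenius[OF p card, of r n "m i"] r True by (simp add: y_def d_def)
      next
        case False
        then have eq: "s = chain_len n i" "r = n" using \<open>s \<le> chain_len n i\<close> chain_len_le by (auto simp: r_def)
        have n: "1 \<le> n" using i' by auto
        \<comment> \<open>At the end of the chain the factor is a power of \<open>d n\<close>, whose
          first nontrivial operation has larger degree than the one applied.\<close>
        have "\<mu> - s < m i + chain_len n n - 1" using eq s i'(3) n by (auto simp: chain_len_def[of n n])
        then have "p ^ (\<mu> - s) < p ^ (m i + chain_len n n - 1)"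
          using prime_gt_1_nat[OF p] by (intro power_strict_increasing) auto
        then show ?thesis
          using jet_lower[OF jet_dickson_frobenius[OF p card n order_refl]] False
          by (simp add: y_def d_def eq)
      qed
      then have "jet p (p ^ (\<mu> - s)) (mconst (\<gamma> i) * (W i * R i * d r ^ p ^ m i))
                  (mconst (\<gamma> i) * (W i * R i * y + d r ^ p ^ m i * 0))"
        using cof pos by (intro jet_mconst_mult jet_mult)
      also have "mconst (\<gamma> i) * (W i * R i * d r ^ p ^ m i) = X i s"
        using True by (simp add: X_def r_def mult.assoc)
      also have "mconst (\<gamma> i) * (W i * R i * y + d r ^ p ^ m i * 0) = X i (Suc s)"
        by (simp add: X_def r_def y_def mult.assoc)
      finally show ?thesis .
    qed
  qed
  have steps: "stPcomp p \<mu> (Suc s) dK = (\<Sum>i\<in>I. X i (Suc s))" if "s \<le> \<mu>" for s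
    using that
  proof (induction s)
    case 0
    have "jet p (p ^ \<mu>) (\<Prod>i\<in>{1..n}. d i ^ k i) (\<Sum>i\<in>{1..n}.
      (if i \<in> I then mconst (\<gamma> i) * W i * d (n - chain_len n i + 1) ^ p ^ m i else 0) * R i)"
      unfolding R_def by (intro jet_prod jet_factor pos) auto
    also have "(\<Prod>i\<in>{1..n}. d i ^ k i) = dK" by (simp add: dK d_def)
    also have "(\<Sum>i\<in>{1..n}.
      (if i \<in> I then mconst (\<gamma> i) * W i * d (n - chain_len n i + 1) ^ p ^ m i else 0) * R i) =
      (\<Sum>i\<in>{1..n}. if i \<in> I then X i 1 else 0)"
      by (rule sum.cong) (use chain_len_pos in \<open>auto simp: X_def mult_ac\<close>)
    also have "\<dots> = (\<Sum>i\<in>{1..n} \<inter> I. X i 1)"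
      by (simp only: sum.inter_restrict finite_atLeastAtMost)
    also have "{1..n} \<inter> I = I" by (auto simp: I)
    finally have "stP p (p ^ \<mu>) dK = (\<Sum>i\<in>I. X i 1)"
      using pos p by (intro jet_imp_stP) (auto simp: prime_gt_0_nat)
    then show ?case by simp
  next
    case (Suc s)
    have "jet p (p ^ (\<mu> - Suc s)) (\<Sum>i\<in>I. X i (Suc s)) (\<Sum>i\<in>I. X i (Suc (Suc s)))"
      using Suc.prems by (intro jet_sum jet_step) auto
    then have "stP p (p ^ (\<mu> - Suc s)) (\<Sum>i\<in>I. X i (Suc s)) = (\<Sum>i\<in>I. X i (Suc (Suc s)))"
      using pos p by (intro jet_imp_stP) (auto simp: prime_gt_0_nat)
    moreover have "stPcomp p \<mu> (Suc s) dK = (\<Sum>i\<in>I. X i (Suc s))"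
      using Suc by simp
    ultimately show ?case by (simp only: stPcomp.simps(2)[of p \<mu> "Suc s"])
  qed
  show thesis
    by (rule that[OF \<gamma>(1)]) (simp only: steps X_def W_def R_def d_def)
qed

section \<open>Selection of the longest chain\<close>

theorem mainTheorem3:
  fixes p n :: nat and k :: "nat \<Rightarrow> nat"
    and m e :: "nat \<Rightarrow> nat" and \<mu> \<iota> :: nat
    and dK :: "'a::{finite,field} mpoly"
  assumes "prime p" and "card (UNIV :: 'a set) = p"
    and "\<exists>i\<in>{1..n}. k i \<noteq> 0"
    and "dK = (\<Prod>i\<in>{1..n}. dickson p n i ^ k i)"
    and "\<And>i. m i = multiplicity p (k i)"
    and "\<And>i. e i = (if i < n then m i + n - i - 1 else m n + n - 1)"
    and "\<mu> = Min {e i | i. i \<in> {1..n} \<and> k i \<noteq> 0}"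
    and "\<iota> = Max ({n - i | i. 1 \<le> i \<and> i < n \<and> k i \<noteq> 0 \<and> e i = \<mu>}
                 \<union> (if k n \<noteq> 0 \<and> e n = \<mu> then {n} else {}))"
  shows "\<exists>u::'a. u \<noteq> 0 \<and>
    (if \<iota> = n
     then stPcomp p \<mu> \<iota> dK = mconst u * dickson p n n ^ (p ^ m n) * dK
     else stPcomp p \<mu> \<iota> dK * dickson p n (n - \<iota>) ^ (p ^ m (n - \<iota>))
            = mconst u * dickson p n n ^ (p ^ m (n - \<iota>)) * dK)"
proof -
  note p = assms(1) and card = assms(2) and m = assms(5)
  have e: "e i = m i + chain_len n i - 1" if "i \<in> {1..n}" for i
    using that by (auto simp: assms(6) chain_len_def)
  define I where "I = {i \<in> {1..n}. k i \<noteq> 0 \<and> m i + chain_len n i - 1 = \<mu>}"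
  have fin: "finite {e i | i. i \<in> {1..n} \<and> k i \<noteq> 0}" by simp
  have \<mu>_le: "\<mu> \<le> m i + chain_len n i - 1" if "i \<in> {1..n}" "k i \<noteq> 0" for i
  proof -
    have "e i \<in> {e i | i. i \<in> {1..n} \<and> k i \<noteq> 0}" using that by blast
    then have "\<mu> \<le> e i" unfolding assms(7) by (rule Min_le[OF fin])
    then show ?thesis using e[OF that(1)] by simp
  qed
  have "\<mu> \<in> {e i | i. i \<in> {1..n} \<and> k i \<noteq> 0}"
    unfolding assms(7) using fin assms(3) by (intro Min_in) auto
  then have "I \<noteq> {}" using e by (auto simp: I_def)
  have n: "n \<ge> 1" using assms(3) by auto
  \<comment> \<open>The two sets defining \<iota> are the chain lengths of the indices in
    \<open>I\<close>, split by \<open>i < n\<close> and \<open>i = n\<close>.\<close>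
  have "{n - i | i. 1 \<le> i \<and> i < n \<and> k i \<noteq> 0 \<and> e i = \<mu>} = chain_len n ` {i \<in> I. i < n}"
    using e by (force simp: I_def chain_len_def)
  moreover have "(if k n \<noteq> 0 \<and> e n = \<mu> then {n} else {}) = chain_len n ` {i \<in> I. i = n}"
    using e[of n] n by (auto simp: I_def chain_len_def)
  moreover have "chain_len n ` {i \<in> I. i < n} \<union> chain_len n ` {i \<in> I. i = n} = chain_len n ` I"
  proof -
    have "{i \<in> I. i < n} \<union> {i \<in> I. i = n} = I" by (auto simp: I_def)
    then show ?thesis by (simp only: flip: image_Un)
  qed
  ultimately have \<iota>: "\<iota> = Max (chain_len n ` I)" using assms(8) by simp
  have finI: "finite I" by (simp add: I_def)
  then have "\<iota> \<in> chain_len n ` I" unfolding \<iota> using \<open>I \<noteq> {}\<close> by (intro Max_in) auto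
  then obtain a where a: "a \<in> I" "chain_len n a = \<iota>" by auto
  then have a': "a \<in> {1..n}" "k a \<noteq> 0" "m a + \<iota> - 1 = \<mu>" by (auto simp: I_def)
  have \<iota>_le: "chain_len n i \<le> \<iota>" if "i \<in> I" for i
    unfolding \<iota> using finI that by (intro Max_ge) auto
  have "\<iota> \<ge> 1" "\<iota> \<le> n" using a a' by (auto simp: chain_len_def)
  then have \<iota>1: "\<iota> = Suc (\<iota> - 1)" "\<iota> - 1 \<le> \<mu>" using a'(3) by auto
  \<comment> \<open>\<open>chain_len n\<close> is injective on \<open>{1..n}\<close>: it takes
    values below \<open>n\<close> for \<open>i < n\<close> and the value \<open>n\<close> only at
    \<open>i = n\<close>. Hence a single summand survives \<iota> steps.\<close>
  have uniq: "\<iota> \<le> chain_len n i \<longleftrightarrow> i = a" if "i \<in> I" for i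
    using \<iota>_le[OF that] that a' a(2) by (auto simp: I_def chain_len_def split: if_splits)
  let ?W = "(if a < n then dickson p n a ^ (k a - p ^ m a) else dickson p n n ^ k n) *
                (\<Prod>j\<in>{1..n}-{a}. dickson p n j ^ k j) :: 'a mpoly"
  obtain \<gamma> :: "nat \<Rightarrow> 'a" where \<gamma>: "\<And>i. \<gamma> i \<noteq> 0"
    "\<And>s. s \<le> \<mu> \<Longrightarrow> stPcomp p \<mu> (Suc s) dK = (\<Sum>i\<in>I. if Suc s \<le> chain_len n i
        then mconst (\<gamma> i) * ((if i < n then dickson p n i ^ (k i - p ^ m i) else dickson p n n ^ k n) *
                (\<Prod>j\<in>{1..n}-{i}. dickson p n j ^ k j)) * dickson p n (n - chain_len n i + Suc s) ^ p ^ m i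
        else 0)"
    using stPcomp_derivation_sum[OF p card assms(4) m \<mu>_le I_def] by blast
  have "stPcomp p \<mu> \<iota> dK = (\<Sum>i\<in>I. if i = a
        then mconst (\<gamma> i) * ((if i < n then dickson p n i ^ (k i - p ^ m i) else dickson p n n ^ k n) *
                (\<Prod>j\<in>{1..n}-{i}. dickson p n j ^ k j)) * dickson p n (n - chain_len n i + \<iota>) ^ p ^ m i
        else 0)"
    using \<gamma>(2)[OF \<iota>1(2)] uniq unfolding \<iota>1(1)[symmetric] by (simp cong: sum.cong)
  also have "\<dots> = mconst (\<gamma> a) * ?W * dickson p n n ^ p ^ m a"
    using a finI \<open>\<iota> \<le> n\<close> by simp
  finally have st: "stPcomp p \<mu> \<iota> dK = mconst (\<gamma> a) * ?W * dickson p n n ^ p ^ m a" .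
  have split: "dK = dickson p n a ^ k a * (\<Prod>j\<in>{1..n}-{a}. dickson p n j ^ k j)"
    unfolding assms(4) using a'(1) by (intro prod.remove) auto
  show ?thesis
  proof (intro exI[of _ "\<gamma> a"] conjI \<gamma>(1))
    show "if \<iota> = n
     then stPcomp p \<mu> \<iota> dK = mconst (\<gamma> a) * dickson p n n ^ (p ^ m n) * dK
     else stPcomp p \<mu> \<iota> dK * dickson p n (n - \<iota>) ^ (p ^ m (n - \<iota>))
            = mconst (\<gamma> a) * dickson p n n ^ (p ^ m (n - \<iota>)) * dK"
    proof (cases "\<iota> = n")
      case True
      then have "a = n" using a a' by (auto simp: chain_len_def split: if_splits)
      then show ?thesis using True st split by (simp add: mult_ac)
    next
      case False
      then have "a < n" "n - \<iota> = a" using a a' by (auto simp: chain_len_def split: if_splits)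
      have "p ^ m a \<le> k a"
        using a'(2) multiplicity_dvd[of p "k a"] by (simp add: m dvd_imp_le)
      \<comment> \<open>Multiplying by \<open>dickson p n a ^ p ^ m a\<close> restores the power
        consumed by the first operation, which replaces the negative exponent in the informal
        formula.\<close>
      then have "dickson p n a ^ k a = dickson p n a ^ (k a - p ^ m a) * (dickson p n a ^ p ^ m a :: 'a mpoly)"
        by (simp flip: power_add)
      then show ?thesis
        using False st split \<open>a < n\<close> \<open>n - \<iota> = a\<close> by (simp add: mult_ac)
    qed
  qed
qed

end
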